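(* Let $n=2^\alpha$ with $\alpha\ge2$ and $D_n=\langle a,b\mid a^n=b^2=1,\ ab=ba^{-1}\rangle$. Then each connected component of $\Gamma_N(D_n)$ contains a Hamiltonian path.
   Context: $\Gamma_N(G)$ denotes the simple graph whose vertices are the proper non-normal subgroups of the group $G$, two distinct vertices $H,K$ being adjacent iff $HK=KH$. A Hamiltonian path in a graph is a path through all of its vertices. *)

theory Defs
  imports "HOL-Algebra.Coset" "Graph_Theory.Digraph_Component" "Graph_Theory.Vertex_Walk"
begin

section \<open>Groups given by generators and relations\<close>

text \<open>
  A word over the generators \<open>'g\<close> and their formal inverses: the letter \<open>(x, True)\<close> stands for
  \<open>x\<close> and \<open>(x, False)\<close> for the inverse of \<open>x\<close>.
\<close>

type_synonym 'g word = "('g \<times> bool) list"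

text \<open>
  The least congruence on words that contains the relations \<open>R\<close> (a pair \<open>(u, v)\<close> is the
  relation \<open>u = v\<close>) and free cancellation.
\<close>

inductive pres_eq :: "('g word \<times> 'g word) set \<Rightarrow> 'g word \<Rightarrow> 'g word \<Rightarrow> bool"
  for R :: "('g word \<times> 'g word) set" where
  relation: "(u, v) \<in> R \<Longrightarrow> pres_eq R u v"
| cancel: "pres_eq R [(x, s), (x, \<not> s)] []"
| refl: "pres_eq R u u"
| sym: "pres_eq R u v \<Longrightarrow> pres_eq R v u"
| trans: "pres_eq R u v \<Longrightarrow> pres_eq R v w \<Longrightarrow> pres_eq R u w"
| append: "pres_eq R u u' \<Longrightarrow> pres_eq R v v' \<Longrightarrow> pres_eq R (u @ v) (u' @ v')"

definition pres_rel :: "('g word \<times> 'g word) set \<Rightarrow> 'g word rel" where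
  "pres_rel R = {(u, v). pres_eq R u v}"

definition presented_group :: "('g word \<times> 'g word) set \<Rightarrow> 'g word set monoid" where
  "presented_group R =
     \<lparr> carrier = UNIV // pres_rel R,
       monoid.mult = (\<lambda>U V. \<Union>u\<in>U. \<Union>v\<in>V. pres_rel R `` {u @ v}),
       one = pres_rel R `` {[]} \<rparr>"

lemma equiv_pres_rel: "equiv UNIV (pres_rel R)"
  by (rule equivI)
     (auto simp: pres_rel_def refl_on_def sym_def trans_def
       intro: pres_eq.refl pres_eq.sym pres_eq.trans)

lemma presented_group_mult:
  "(pres_rel R `` {u}) \<otimes>\<^bsub>presented_group R\<^esub> (pres_rel R `` {v}) = pres_rel R `` {u @ v}"
proof -
  have "congruent2 (pres_rel R) (pres_rel R) (\<lambda>u v. pres_rel R `` {u @ v})"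
    by (rule congruent2I', rule equiv_class_eq[OF equiv_pres_rel])
       (auto simp: pres_rel_def intro: pres_eq.append)
  then show ?thesis
    unfolding presented_group_def
    by (simp add: UN_equiv_class2[OF equiv_pres_rel equiv_pres_rel])
qed

lemma pres_eq_inverse_word:
  "pres_eq R (rev (map (\<lambda>(x, s). (x, \<not> s)) w) @ w) []"
proof (induction w)
  case Nil
  show ?case by (simp add: pres_eq.refl)
next
  case (Cons l w)
  obtain x s where l: "l = (x, s)" by (cases l)
  let ?v = "rev (map (\<lambda>(x, s). (x, \<not> s)) w)"
  have c: "pres_eq R [(x, \<not> s), (x, s)] []"
    using pres_eq.cancel[of R x "\<not> s"] by simp
  have "pres_eq R (?v @ ([(x, \<not> s), (x, s)] @ w)) (?v @ ([] @ w))"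
    by (intro pres_eq.append pres_eq.refl c)
  then show ?case
    using Cons.IH l by (auto intro: pres_eq.trans)
qed

lemma group_presented_group: "group (presented_group R)"
proof (rule groupI)
  have cls: "\<exists>u. X = pres_rel R `` {u}" if "X \<in> carrier (presented_group R)" for X
    using that by (auto simp: presented_group_def quotient_def)
  have one: "\<one>\<^bsub>presented_group R\<^esub> = pres_rel R `` {[]}"
    by (simp add: presented_group_def)
  have closed: "pres_rel R `` {u} \<in> carrier (presented_group R)" for u
    by (simp add: presented_group_def quotientI)
  show "\<one>\<^bsub>presented_group R\<^esub> \<in> carrier (presented_group R)"
    by (simp add: one closed)
  fix X assume X: "X \<in> carrier (presented_group R)"
  then obtain u where u: "X = pres_rel R `` {u}" using cls by blast
  show "\<one>\<^bsub>presented_group R\<^esub> \<otimes>\<^bsub>presented_group R\<^esub> X = X"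
    by (simp add: one u presented_group_mult)
  show "\<exists>Y\<in>carrier (presented_group R). Y \<otimes>\<^bsub>presented_group R\<^esub> X = \<one>\<^bsub>presented_group R\<^esub>"
  proof
    let ?v = "rev (map (\<lambda>(x, s). (x, \<not> s)) u)"
    show "pres_rel R `` {?v} \<in> carrier (presented_group R)" by (rule closed)
    show "pres_rel R `` {?v} \<otimes>\<^bsub>presented_group R\<^esub> X = \<one>\<^bsub>presented_group R\<^esub>"
      unfolding one u presented_group_mult
      by (rule equiv_class_eq[OF equiv_pres_rel]) (simp add: pres_rel_def pres_eq_inverse_word)
  qed
  fix Y assume Y: "Y \<in> carrier (presented_group R)"
  then obtain v where v: "Y = pres_rel R `` {v}" using cls by blast
  show "X \<otimes>\<^bsub>presented_group R\<^esub> Y \<in> carrier (presented_group R)"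
    by (simp add: u v presented_group_mult closed)
  fix Z assume Z: "Z \<in> carrier (presented_group R)"
  then obtain w where w: "Z = pres_rel R `` {w}" using cls by blast
  show "X \<otimes>\<^bsub>presented_group R\<^esub> Y \<otimes>\<^bsub>presented_group R\<^esub> Z =
        X \<otimes>\<^bsub>presented_group R\<^esub> (Y \<otimes>\<^bsub>presented_group R\<^esub> Z)"
    by (simp add: u v w presented_group_mult)
qed


section \<open>The dihedral group of order \<open>2 n\<close>\<close>

datatype dihedral_gen = gen_a | gen_b

definition dihedral_relations :: "nat \<Rightarrow> (dihedral_gen word \<times> dihedral_gen word) set" where
  "dihedral_relations n =
     {(replicate n (gen_a, True), []),
      ([(gen_b, True), (gen_b, True)], []),
      ([(gen_a, True), (gen_b, True)], [(gen_b, True), (gen_a, False)])}"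

definition dihedral_group :: "nat \<Rightarrow> dihedral_gen word set monoid" where
  "dihedral_group n = presented_group (dihedral_relations n)"


section \<open>The permutability graph of non-normal subgroups\<close>

text \<open>
  As usual in the graph library, an undirected simple graph is a loop-free digraph with a
  symmetric arc relation, see the lemma below.
\<close>

definition perm_graph_nonnormal :: "('a, 'b) monoid_scheme \<Rightarrow> 'a set pair_pre_digraph" where
  "perm_graph_nonnormal G =
     (let V = {H. subgroup H G \<and> H \<noteq> carrier G \<and> \<not> H \<lhd> G}
      in \<lparr> pverts = V,
           parcs = {(H, K). H \<in> V \<and> K \<in> V \<and> H \<noteq> K \<and> H <#>\<^bsub>G\<^esub> K = K <#>\<^bsub>G\<^esub> H} \<rparr>)"

lemma pair_bidirected_digraph_perm_graph_nonnormal: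
  "pair_bidirected_digraph (perm_graph_nonnormal G)"
  by unfold_locales
     (auto simp: perm_graph_nonnormal_def Let_def symmetric_def intro!: symI)


section \<open>Connected components and Hamiltonian paths\<close>

definition connected_component :: "('a, 'b) pre_digraph \<Rightarrow> ('a, 'b) pre_digraph \<Rightarrow> bool" where
  "connected_component G C \<longleftrightarrow> pre_digraph.max_subgraph G connected C"

definition hamiltonian_path :: "'a vwalk \<Rightarrow> ('a, 'b) pre_digraph \<Rightarrow> bool" where
  "hamiltonian_path p G \<longleftrightarrow> vpath p G \<and> set p = verts G"

end

(*
  The non-normal subgroups of D_n, n = 2^alpha, are the dihedral subgroups
  S(l,j) = <a^(2^l), a^j b> with 2 <= l <= alpha and j taken mod 2^l, and S(l,j) permutes with
  S(l',j') iff j = j' mod 2^(min(l,l') - 1). So the parity of j is constant on components.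
  The two subgroups S(k+1,i), S(k+1,i+2^k) permute with all S(l,j) such that l > k and
  j = i mod 2^k, and the remaining ones of these split into the same configurations for (k+1,i)
  and (k+1,i+2^k). Hence a Hamiltonian path P(k,i) of all of them is obtained recursively as
  S(k+1,i), P(k+1,i), S(k+1,i+2^k), P(k+1,i+2^k), and P(1,i) exhausts a parity class.
*)

theory Submission
  imports Defs "HOL-Computational_Algebra.Primes"
begin

section \<open>The word problem of the presentation, solved by normal forms a^i b^s\<close>

section \<open>Words modulo the dihedral relations\<close>

text \<open>With \<open>flips\<close>, this gives the normal form a^i b^s of a word, with i taken in
  the integers. Moving b to the right past a power of a inverts that power, and b is its own
  inverse, so the sign of a letter \<open>gen_b\<close> is ignored.\<close>

fun rot_exp :: "dihedral_gen word \<Rightarrow> int" where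
  "rot_exp [] = 0"
| "rot_exp ((gen_a, s) # w) = (if s then 1 else -1) + rot_exp w"
| "rot_exp ((gen_b, s) # w) = - rot_exp w"

fun flips :: "dihedral_gen word \<Rightarrow> bool" where
  "flips [] = False"
| "flips ((gen_a, s) # w) = flips w"
| "flips ((gen_b, s) # w) = (\<not> flips w)"

lemma flips_append [simp]: "flips (u @ v) \<longleftrightarrow> flips u \<noteq> flips v"
  by (induction u rule: flips.induct) auto

lemma rot_exp_append [simp]:
  "rot_exp (u @ v) = rot_exp u + (if flips u then - rot_exp v else rot_exp v)"
  by (induction u rule: rot_exp.induct) auto

lemma rot_exp_replicate [simp]: "rot_exp (replicate m (gen_a, True)) = int m"
  and flips_replicate [simp]: "\<not> flips (replicate m (gen_a, True))"
  by (induction m) auto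

text \<open>Needed to choose a representing word for every pair of invariants.\<close>

lemma ex_word: "\<exists>w. rot_exp w = i \<and> flips w = s"
proof (induction i rule: int_induct[where k = 0])
  case base
  have "rot_exp (if s then [(gen_b, True)] else []) = 0 \<and> flips (if s then [(gen_b, True)] else []) = s"
    by simp
  then show ?case by blast
next
  case (step1 i)
  then obtain w where "rot_exp w = i" "flips w = s" by blast
  then have "rot_exp ((gen_a, True) # w) = i + 1" "flips ((gen_a, True) # w) = s" by simp_all
  then show ?case by blast
next
  case (step2 i)
  then obtain w where "rot_exp w = i" "flips w = s" by blast
  then have "rot_exp ((gen_a, False) # w) = i - 1" "flips ((gen_a, False) # w) = s" by simp_all
  then show ?case by blast
qed

text \<open>Soundness of the invariants: each defining relation and each cancellation preserves
  them, and concatenation is compatible with them.\<close>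

lemma pres_eq_dihedralD:
  assumes "pres_eq (dihedral_relations n) u v"
  shows "int n dvd rot_exp u - rot_exp v \<and> flips u = flips v"
  using assms
proof induction
  case (relation u v)
  then show ?case by (auto simp: dihedral_relations_def)
next
  case (cancel x s)
  then show ?case by (cases x) auto
next
  case (sym u v)
  then show ?case by (simp add: dvd_diff_commute)
next
  case (trans u v w)
  then show ?case using dvd_add[of "int n" "rot_exp u - rot_exp v" "rot_exp v - rot_exp w"] by simp
next
  case (append u u' v v')
  \<comment> \<open>The exponent of the second factor enters with a sign that depends on
    \<open>flips u\<close>, so both the sum and the difference are provided.\<close>
  then have "int n dvd (rot_exp u - rot_exp u') + (rot_exp v - rot_exp v')"
    "int n dvd (rot_exp u - rot_exp u') - (rot_exp v - rot_exp v')"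
    by (blast intro: dvd_add dvd_diff)+
  then show ?case using append by (simp add: algebra_simps)
qed simp

lemma (in group) int_pow_conj_inv:
  assumes x: "x \<in> carrier G" and y: "y \<in> carrier G" and xy: "x \<otimes> y = y \<otimes> inv x"
  shows "y \<otimes> x [^] (i::int) = x [^] (- i) \<otimes> y"
proof (induction i rule: int_induct[where k = 0])
  case base
  then show ?case using x y by simp
next
  case (step1 i)
  have yx: "y \<otimes> x = inv x \<otimes> y"
    using x y xy by (metis inv_closed inv_solve_left inv_solve_right m_assoc m_closed)
  have "y \<otimes> x [^] (i + 1) = (y \<otimes> x [^] i) \<otimes> x"
    using x y by (simp add: int_pow_mult m_assoc)
  also have "\<dots> = x [^] (- i) \<otimes> (inv x \<otimes> y)"
    using x y step1 yx by (simp add: m_assoc)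
  also have "\<dots> = x [^] (- i + - 1) \<otimes> y"
    using x y by (simp only: int_pow_mult) (simp add: int_pow_neg m_assoc)
  finally show ?case by simp
next
  case (step2 i)
  have "y \<otimes> x [^] (i - 1) = y \<otimes> x [^] (i + - 1)" by simp
  also have "\<dots> = (y \<otimes> x [^] i) \<otimes> inv x"
    using x y by (simp only: int_pow_mult) (simp add: int_pow_neg m_assoc)
  also have "\<dots> = x [^] (- i) \<otimes> (x \<otimes> y)"
    using x y step2 xy by (simp add: m_assoc)
  also have "\<dots> = x [^] (- i + 1) \<otimes> y"
    using x y by (simp only: int_pow_mult) (simp add: m_assoc)
  finally show ?case by simp
qed

text \<open>Completeness of the invariants comes from computing inside the presented group: every
  class equals its normal form there, and a^n = 1 makes the exponent matter only modulo
  \<open>n\<close>.\<close>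

lemma pres_eq_dihedral_iff:
  "pres_eq (dihedral_relations n) u v \<longleftrightarrow>
     int n dvd rot_exp u - rot_exp v \<and> flips u = flips v"
proof (intro iffI pres_eq_dihedralD)
  let ?R = "dihedral_relations n"
  let ?G = "dihedral_group n"
  define cl where "cl w = pres_rel ?R `` {w}" for w
  interpret group ?G
    unfolding dihedral_group_def by (rule group_presented_group)
  have closed: "cl w \<in> carrier ?G" for w
    by (simp add: cl_def dihedral_group_def presented_group_def quotientI)
  have one: "\<one>\<^bsub>?G\<^esub> = cl []"
    by (simp add: cl_def dihedral_group_def presented_group_def)
  have mult: "cl u \<otimes>\<^bsub>?G\<^esub> cl v = cl (u @ v)" for u v
    unfolding cl_def dihedral_group_def by (rule presented_group_mult)
  have cl_eq: "cl u = cl v \<longleftrightarrow> pres_eq ?R u v" for u v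
    unfolding cl_def by (subst eq_equiv_class_iff[OF equiv_pres_rel]) (auto simp: pres_rel_def)
  define a b where "a = cl [(gen_a, True)]" and "b = cl [(gen_b, True)]"
  have ab: "a \<in> carrier ?G" "b \<in> carrier ?G" by (simp_all add: a_def b_def closed)
  have inv_letter: "cl [(x, False)] = inv\<^bsub>?G\<^esub> (cl [(x, True)])" for x
  proof (rule inv_equality[symmetric])
    show "cl [(x, False)] \<otimes>\<^bsub>?G\<^esub> cl [(x, True)] = \<one>\<^bsub>?G\<^esub>"
      using pres_eq.cancel[of ?R x False] by (simp add: mult one cl_eq)
  qed (rule closed)+
  have bb: "b \<otimes>\<^bsub>?G\<^esub> b = \<one>\<^bsub>?G\<^esub>"
    unfolding b_def mult one cl_eq by (rule pres_eq.relation) (simp add: dihedral_relations_def)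
  then have inv_b: "inv\<^bsub>?G\<^esub> b = b"
    using ab by (intro inv_equality)
  have rel_ab: "a \<otimes>\<^bsub>?G\<^esub> b = b \<otimes>\<^bsub>?G\<^esub> inv\<^bsub>?G\<^esub> a"
    unfolding a_def b_def inv_letter[symmetric] mult cl_eq
    by (rule pres_eq.relation) (simp add: dihedral_relations_def)
  have conj: "b \<otimes>\<^bsub>?G\<^esub> a [^]\<^bsub>?G\<^esub> i = a [^]\<^bsub>?G\<^esub> (- i) \<otimes>\<^bsub>?G\<^esub> b" for i :: int
    by (rule int_pow_conj_inv[OF ab rel_ab])
  have "a [^]\<^bsub>?G\<^esub> m = cl (replicate m (gen_a, True))" for m :: nat
    by (induction m) (simp_all add: one a_def mult replicate_append_same)
  moreover have "cl (replicate n (gen_a, True)) = cl []"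
    unfolding cl_eq by (rule pres_eq.relation) (simp add: dihedral_relations_def)
  ultimately have a_n: "a [^]\<^bsub>?G\<^esub> int n = \<one>\<^bsub>?G\<^esub>" by (simp add: int_pow_int one)
  have letter_b: "cl [(gen_b, s)] = b" for s
    using inv_letter[of gen_b] inv_b by (cases s) (simp_all add: b_def)
  have letter_a: "cl [(gen_a, s)] = a [^]\<^bsub>?G\<^esub> (if s then 1 else -1 :: int)" for s
    using inv_letter[of gen_a] ab by (cases s) (simp_all add: a_def int_pow_neg)
  \<comment> \<open>Induction letter by letter: a letter a adds to the exponent, and a letter b is
    carried past the power of a by \<open>conj\<close>.\<close>
  have normal_form:
    "cl w = a [^]\<^bsub>?G\<^esub> rot_exp w \<otimes>\<^bsub>?G\<^esub> (if flips w then b else \<one>\<^bsub>?G\<^esub>)" for w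
  proof (induction w rule: rot_exp.induct)
    case 1
    then show ?case by (simp add: one[symmetric])
  next
    case (2 s w)
    have "cl ((gen_a, s) # w) = cl [(gen_a, s)] \<otimes>\<^bsub>?G\<^esub> cl w" by (simp add: mult)
    then show ?case
      unfolding letter_a 2 rot_exp.simps flips.simps using ab
      by (subst int_pow_mult[OF ab(1)]) (simp add: m_assoc)
  next
    case (3 s w)
    have "cl ((gen_b, s) # w) = cl [(gen_b, s)] \<otimes>\<^bsub>?G\<^esub> cl w" by (simp add: mult)
    also have "\<dots> = (b \<otimes>\<^bsub>?G\<^esub> a [^]\<^bsub>?G\<^esub> rot_exp w) \<otimes>\<^bsub>?G\<^esub> (if flips w then b else \<one>\<^bsub>?G\<^esub>)"
      unfolding letter_b 3 using ab by (simp add: m_assoc)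
    finally show ?case
      unfolding conj using ab bb by (simp add: m_assoc)
  qed
  assume uv: "int n dvd rot_exp u - rot_exp v \<and> flips u = flips v"
  then obtain q where q: "rot_exp u = int n * q + rot_exp v" by (metis diff_add_cancel dvdE)
  have "a [^]\<^bsub>?G\<^esub> (int n * q) = \<one>\<^bsub>?G\<^esub>"
    using ab a_n by (simp flip: int_pow_pow)
  then have "a [^]\<^bsub>?G\<^esub> rot_exp u = a [^]\<^bsub>?G\<^esub> rot_exp v"
    unfolding q using ab by (simp add: int_pow_mult)
  then have "cl u = cl v" using uv by (simp add: normal_form)
  then show "pres_eq ?R u v" by (simp add: cl_eq)
qed

section \<open>A criterion for permuting subgroups, and an index model of the dihedral group\<close>

section \<open>Subgroups of dihedral groups\<close>

text \<open>One inclusion is enough, because inversion exchanges HK and KH.\<close>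

lemma (in group) set_mult_commuteI:
  assumes H: "subgroup H G" and K: "subgroup K G"
    and sub: "\<And>h k. h \<in> H \<Longrightarrow> k \<in> K \<Longrightarrow> h \<otimes> k \<in> K <#> H"
  shows "H <#> K = K <#> H"
proof
  show "H <#> K \<subseteq> K <#> H" using sub by (auto simp: set_mult_def)
  show "K <#> H \<subseteq> H <#> K"
  proof
    fix z assume "z \<in> K <#> H"
    then obtain k h where kh: "k \<in> K" "h \<in> H" "z = k \<otimes> h" by (auto simp: set_mult_def)
    then have "inv h \<otimes> inv k \<in> K <#> H"
      using sub H K by (simp add: subgroup.m_inv_closed)
    then obtain k' h' where kh': "k' \<in> K" "h' \<in> H" "inv h \<otimes> inv k = k' \<otimes> h'"
      by (auto simp: set_mult_def)
    have carr: "h \<in> carrier G" "k \<in> carrier G" "h' \<in> carrier G" "k' \<in> carrier G"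
      using kh kh' subgroup.mem_carrier[OF H] subgroup.mem_carrier[OF K] by auto
    then have "z = inv (inv h \<otimes> inv k)" by (simp add: kh inv_mult_group)
    also have "\<dots> = inv h' \<otimes> inv k'" using carr by (simp add: kh' inv_mult_group)
    finally show "z \<in> H <#> K"
      using kh' H K by (auto simp: set_mult_def intro: subgroup.m_inv_closed)
  qed
qed

text \<open>Division with remainder by the least positive element, which exists because of
  \<open>n\<close>.\<close>

lemma int_subgroup_cyclic:
  fixes I :: "int set"
  assumes diff: "\<And>x y. x \<in> I \<Longrightarrow> y \<in> I \<Longrightarrow> x - y \<in> I" and n: "int n \<in> I" "n > 0"
  obtains d where "\<And>x. x \<in> I \<longleftrightarrow> int d dvd x"
proof
  define d where "d = (LEAST m. m > 0 \<and> int m \<in> I)"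
  have d: "d > 0" "int d \<in> I" and least: "\<And>m. m > 0 \<Longrightarrow> int m \<in> I \<Longrightarrow> d \<le> m"
    using LeastI[of "\<lambda>m. m > 0 \<and> int m \<in> I" n] n unfolding d_def by (auto intro: Least_le)
  have mult: "int d * q \<in> I" for q
  proof (induction q rule: int_induct[where k = 0])
    case base
    then show ?case using diff[OF d(2) d(2)] by simp
  next
    case (step1 q)
    have "0 - int d \<in> I" using diff[OF diff[OF d(2) d(2)] d(2)] by simp
    then show ?case using diff[OF step1(2)] by (fastforce simp: algebra_simps)
  next
    case (step2 q)
    then show ?case using diff[OF step2(2) d(2)] by (simp add: algebra_simps)
  qed
  fix x
  show "x \<in> I \<longleftrightarrow> int d dvd x"
  proof
    assume x: "x \<in> I"
    have "x mod int d = x - int d * (x div int d)" by (simp add: minus_mult_div_eq_mod)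
    then have "x mod int d \<in> I" using diff[OF x mult] by simp
    moreover have "0 \<le> x mod int d" "x mod int d < int d" using d by auto
    ultimately have "\<not> 0 < x mod int d"
      using least[of "nat (x mod int d)"] by force
    then show "int d dvd x" using \<open>0 \<le> x mod int d\<close> by (simp add: dvd_eq_mod_eq_0)
  qed (auto simp: mult elim!: dvdE)
qed

text \<open>Here \<open>rot i\<close> stands for a^i and \<open>ref i\<close> for a^i b. Indices
  range over all integers and \<open>n\<close> enters only through equality, so products need no
  reduction modulo \<open>n\<close>.\<close>

locale dihedral = group G for G (structure) +
  fixes n :: nat and rot ref :: "int \<Rightarrow> 'a"
  assumes carrier_eq: "carrier G = range rot \<union> range ref"
    and rot_eq_iff: "rot i = rot j \<longleftrightarrow> int n dvd i - j"
    and ref_eq_iff: "ref i = ref j \<longleftrightarrow> int n dvd i - j"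
    and rot_neq_ref [simp]: "rot i \<noteq> ref j"
    and rot_rot [simp]: "rot i \<otimes> rot j = rot (i + j)"
    and rot_ref [simp]: "rot i \<otimes> ref j = ref (i + j)"
    and ref_rot [simp]: "ref i \<otimes> rot j = ref (i - j)"
    and ref_ref [simp]: "ref i \<otimes> ref j = rot (i - j)"

text \<open>By the solved word problem, the classes of words are exactly the sets of words with
  prescribed invariants.\<close>

lemma dihedral_dihedral_group:
  "dihedral (dihedral_group n) n
     (\<lambda>i. {w. int n dvd rot_exp w - i \<and> \<not> flips w})
     (\<lambda>i. {w. int n dvd rot_exp w - i \<and> flips w})"
proof -
  let ?R = "dihedral_relations n"
  \<comment> \<open>The Boolean merges rotations and reflections, so that all four product rules
    become one.\<close>
  define elt where "elt s i = {w. int n dvd rot_exp w - i \<and> flips w = s}" for s i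
  have cl: "pres_rel ?R `` {w} = elt (flips w) (rot_exp w)" for w
    by (auto simp: pres_rel_def pres_eq_dihedral_iff elt_def dvd_diff_commute)
  have elt_cl: "\<exists>w. elt s i = pres_rel ?R `` {w} \<and> rot_exp w = i \<and> flips w = s" for s i
    using ex_word[of i s] by (auto simp: cl)
  have mult: "elt s i \<otimes>\<^bsub>dihedral_group n\<^esub> elt t j = elt (s \<noteq> t) (i + (if s then - j else j))"
    for s t i j
  proof -
    obtain u v where "elt s i = pres_rel ?R `` {u}" "rot_exp u = i" "flips u = s"
      "elt t j = pres_rel ?R `` {v}" "rot_exp v = j" "flips v = t"
      using elt_cl by metis
    then show ?thesis
      by (simp add: dihedral_group_def presented_group_mult) (simp add: cl)
  qed
  have eq: "elt s i = elt t j \<longleftrightarrow> int n dvd i - j \<and> s = t" for s t i j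
  proof -
    obtain u v where "elt s i = pres_rel ?R `` {u}" "rot_exp u = i" "flips u = s"
      "elt t j = pres_rel ?R `` {v}" "rot_exp v = j" "flips v = t"
      using elt_cl by metis
    then show ?thesis
      by (simp add: eq_equiv_class_iff[OF equiv_pres_rel])
        (simp add: pres_rel_def pres_eq_dihedral_iff)
  qed
  have "carrier (dihedral_group n) = {elt s i | s i. True}"
  proof -
    have "\<exists>w. elt s i = pres_rel ?R `` {w}" for s i using elt_cl by blast
    moreover have "\<exists>s i. pres_rel ?R `` {w} = elt s i" for w using cl by blast
    ultimately show ?thesis
      unfolding dihedral_group_def presented_group_def quotient_def partial_object.simps by blast
  qed
  also have "\<dots> = range (elt False) \<union> range (elt True)"
  proof (rule Set.set_eqI)
    fix X
    show "X \<in> {elt s i | s i. True} \<longleftrightarrow> X \<in> range (elt False) \<union> range (elt True)"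
      unfolding mem_Collect_eq Un_iff image_iff
      using ex_bool_eq[of "\<lambda>s. \<exists>i. X = elt s i"] by (simp add: disj_commute)
  qed
  finally have carrier: "carrier (dihedral_group n) = range (elt False) \<union> range (elt True)" .
  interpret group "dihedral_group n"
    unfolding dihedral_group_def by (rule group_presented_group)
  have "dihedral (dihedral_group n) n (elt False) (elt True)"
    by unfold_locales (simp_all add: carrier mult eq)
  then show ?thesis by (simp add: elt_def[abs_def])
qed

section \<open>The subgroups generated by a^d and a^i b: permutability, normality,
  classification\<close>

context dihedral
begin

lemma rot_closed [simp]: "rot i \<in> carrier G" and ref_closed [simp]: "ref i \<in> carrier G"
  by (simp_all add: carrier_eq)

lemma ref_neq_rot [simp]: "ref i \<noteq> rot j"
  using rot_neq_ref by metis

lemma one_eq: "\<one> = rot 0"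
  using rot_rot[of 0 0] rot_closed[of 0] by (metis add.right_neutral l_cancel_one')

lemma inv_rot [simp]: "inv (rot i) = rot (- i)"
  by (rule inv_equality) (simp_all add: one_eq)

lemma inv_ref [simp]: "inv (ref i) = ref i"
  by (rule inv_equality) (simp_all add: one_eq)

lemma carrierE:
  assumes "x \<in> carrier G"
  obtains i where "x = rot i" | i where "x = ref i"
  using assms by (auto simp: carrier_eq)

text \<open>The subgroup generated by a^d and a^i b.\<close>

definition sub :: "int \<Rightarrow> int \<Rightarrow> 'a set" where
  "sub d i = rot ` {x. d dvd x} \<union> ref ` {x. d dvd x - i}"

text \<open>An element determines its index only modulo \<open>n\<close>; the assumption makes
  divisibility by \<open>d\<close> independent of the chosen index.\<close>

lemma rot_in_sub: "d dvd int n \<Longrightarrow> rot x \<in> sub d i \<longleftrightarrow> d dvd x"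
  by (auto simp: sub_def rot_eq_iff image_iff)
    (metis dvd_trans dvd_add diff_add_cancel)

lemma ref_in_sub:
  assumes "d dvd int n"
  shows "ref x \<in> sub d i \<longleftrightarrow> d dvd x - i"
proof
  assume "ref x \<in> sub d i"
  then obtain y where "d dvd y - i" "int n dvd x - y"
    by (auto simp: sub_def ref_eq_iff)
  then have "d dvd (x - y) + (y - i)" using assms by (metis dvd_trans dvd_add)
  then show "d dvd x - i" by simp
qed (auto simp: sub_def)

lemma sub_subset: "sub d i \<subseteq> carrier G"
  by (auto simp: sub_def)

lemma sub_cong:
  assumes "d dvd i - j"
  shows "sub d i = sub d j"
proof -
  have "d dvd x - i \<longleftrightarrow> d dvd x - j" for x
    using assms dvd_add_right_iff[of d "i - j" "x - i"] by simp
  then show ?thesis by (simp add: sub_def)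
qed

lemma rot_subI: "d dvd x \<Longrightarrow> rot x \<in> sub d i"
  and ref_subI: "d dvd x - i \<Longrightarrow> ref x \<in> sub d i"
  by (auto simp: sub_def)

lemma subE:
  assumes "g \<in> sub d i"
  obtains x where "g = rot x" "d dvd x" | x where "g = ref x" "d dvd x - i"
  using assms by (auto simp: sub_def)

lemma sub_subgroup: "subgroup (sub d i) G"
proof (rule subgroupI)
  show "sub d i \<noteq> {}" by (auto simp: sub_def)
next
  fix g assume "g \<in> sub d i"
  then show "inv g \<in> sub d i" by (elim subE) (simp_all add: rot_subI ref_subI)
next
  fix g h assume "g \<in> sub d i" "h \<in> sub d i"
  then show "g \<otimes> h \<in> sub d i"
  proof (elim subE; clarsimp)
    fix x y assume "d dvd x" "d dvd y"
    then show "rot (x + y) \<in> sub d i" by (intro rot_subI dvd_add)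
  next
    fix x y assume "d dvd x" "d dvd y - i"
    then show "ref (x + y) \<in> sub d i"
      using dvd_add[of d x "y - i"] by (intro ref_subI) (simp add: algebra_simps)
  next
    fix x y assume "d dvd x - i" "d dvd y"
    then show "ref (x - y) \<in> sub d i"
      using dvd_diff[of d "x - i" y] by (intro ref_subI) (simp add: algebra_simps)
  next
    fix x y assume "d dvd x - i" "d dvd y - i"
    then show "rot (x - y) \<in> sub d i"
      using dvd_diff[of d "x - i" "y - i"] by (intro rot_subI) simp
  qed
qed (rule sub_subset)

text \<open>Under these hypotheses \<open>sub e j\<close> normalizes \<open>sub d i\<close>: its
  rotations move the index of a reflection by multiples of \<open>2 * e\<close>, and conjugation by
  \<open>ref y\<close> sends \<open>ref x\<close> to \<open>ref (2 * y - x)\<close>, where 2y - x is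
  again i modulo \<open>d\<close>.\<close>

lemma sub_permute:
  assumes "d dvd e" and "d dvd 2 * (i - j)"
  shows "sub d i <#> sub e j = sub e j <#> sub d i"
proof (rule set_mult_commuteI[OF sub_subgroup sub_subgroup])
  fix g h assume g: "g \<in> sub d i" and h: "h \<in> sub e j"
  show "g \<otimes> h \<in> sub e j <#> sub d i"
  proof -
    have "\<exists>h'\<in>sub e j. \<exists>g'\<in>sub d i. g \<otimes> h = h' \<otimes> g'"
    proof (cases rule: subE[OF g]; cases rule: subE[OF h])
      fix x y assume "g = rot x" "h = rot y"
      then show ?thesis by (intro bexI[OF _ h] bexI[OF _ g]) (simp add: add.commute)
    next
      fix x y assume "g = rot x" "d dvd x" "h = ref y"
      then show ?thesis by (intro bexI[OF _ h] bexI[of _ "rot (- x)"]) (simp_all add: rot_subI add.commute)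
    next
      fix x y assume "g = ref x" "h = rot y" "e dvd y"
      then show ?thesis by (intro bexI[of _ "rot (- y)"] bexI[OF _ g]) (simp_all add: rot_subI)
    next
      \<comment> \<open>The only case that uses the assumption on \<open>2 * (i - j)\<close>. The
        witness is the conjugate of \<open>ref x\<close> by \<open>ref y\<close>.\<close>
      fix x y assume x: "g = ref x" "d dvd x - i" and y: "h = ref y" "e dvd y - j"
      have "d dvd 2 * (y - j) - (x - i) - 2 * (i - j)"
        using x y assms by (meson dvd_diff dvd_mult dvd_trans)
      then have "ref (2 * y - x) \<in> sub d i" by (intro ref_subI) (simp add: algebra_simps)
      then show ?thesis using x y by (intro bexI[OF _ h] bexI[of _ "ref (2 * y - x)"]) simp_all
    qed
    then show ?thesis by (auto simp: set_mult_def)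
  qed
qed

text \<open>The product of \<open>ref i\<close> and \<open>ref j\<close> is
  \<open>rot (i - j)\<close> and must be a product in the other order. Two rotations there give i -
  j = 0 modulo \<open>c\<close>; two reflections give i - j = j - i.\<close>

lemma sub_permuteD:
  assumes "c dvd d" "c dvd e" "c dvd int n" and eq: "sub d i <#> sub e j = sub e j <#> sub d i"
  shows "c dvd 2 * (i - j)"
proof -
  have "ref i \<in> sub d i" "ref j \<in> sub e j" by (simp_all add: ref_subI)
  then have "ref i \<otimes> ref j \<in> sub d i <#> sub e j"
    unfolding set_mult_def by blast
  then obtain h g where h: "h \<in> sub e j" and g: "g \<in> sub d i" and hg: "h \<otimes> g = rot (i - j)"
    unfolding eq by (auto simp: set_mult_def)
  show ?thesis
  proof (cases rule: subE[OF h]; cases rule: subE[OF g])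
    fix x y assume "h = rot y" "e dvd y" "g = rot x" "d dvd x"
    moreover from this hg assms have "c dvd (y + x) - (i - j)"
      by (auto simp: rot_eq_iff intro: dvd_trans)
    ultimately have "c dvd 2 * (y + x - ((y + x) - (i - j)))"
      using assms by (meson dvd_add dvd_diff dvd_mult dvd_trans)
    then show ?thesis by simp
  next
    fix x y assume "h = ref y" "e dvd y - j" "g = ref x" "d dvd x - i"
    moreover from this hg assms have "c dvd (y - x) - (i - j)"
      by (auto simp: rot_eq_iff intro: dvd_trans)
    ultimately have "c dvd ((y - j) - (x - i)) - ((y - x) - (i - j))"
      using assms by (meson dvd_diff dvd_trans)
    then show ?thesis by (simp add: algebra_simps)
  qed (use hg in simp_all)
qed

text \<open>The rotations contained in the subgroup determine \<open>d\<close>, and its reflections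
  determine \<open>i\<close> modulo \<open>d\<close>.\<close>

lemma sub_eqD:
  assumes "d dvd int n" "e dvd int n" "d \<ge> 0" "e \<ge> 0" and eq: "sub d i = sub e j"
  shows "d = e" and "d dvd i - j"
proof -
  have "d dvd e" "e dvd d"
    using rot_in_sub[of d e i] rot_in_sub[of e e j] rot_in_sub[of d d i] rot_in_sub[of e d j] assms
    by auto
  then show "d = e" using assms by (simp add: zdvd_antisym_nonneg)
  then show "d dvd i - j"
    using ref_in_sub[of e i j] ref_in_sub[of d i i] assms by auto
qed

text \<open>Conjugation by \<open>rot 1\<close> shifts the index of a reflection by 2, and every
  conjugation changes it by an even number.\<close>

lemma sub_normal_iff:
  assumes "d dvd int n"
  shows "sub d i \<lhd> G \<longleftrightarrow> d dvd 2"
proof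
  assume "sub d i \<lhd> G"
  then have "rot 1 \<otimes> ref i \<otimes> inv (rot 1) \<in> sub d i"
    by (rule normal.inv_op_closed2) (auto intro: ref_subI)
  then show "d dvd 2" using assms by (simp add: ref_in_sub)
next
  assume d: "d dvd 2"
  have "g \<otimes> h \<otimes> inv g \<in> sub d i" if g: "g \<in> carrier G" and h: "h \<in> sub d i" for g h
  proof (cases rule: carrierE[OF g]; cases rule: subE[OF h])
    fix x y assume "g = rot y" "h = ref x" "d dvd x - i"
    then show ?thesis using d dvd_add[of d "x - i" "2 * y"]
      by (auto intro!: ref_subI simp: algebra_simps)
  next
    fix x y assume "g = ref y" "h = ref x" "d dvd x - i"
    then show ?thesis using d dvd_add[of d "x - i" "2 * (y - x)"]
      by (auto intro!: ref_subI simp: algebra_simps)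
  qed (auto intro: rot_subI)
  then show "sub d i \<lhd> G" by (auto simp: normal_inv_iff sub_subgroup)
qed

text \<open>Rotations commute with each other, and a reflection conjugates each rotation to its
  inverse.\<close>

lemma rotations_normal:
  assumes "subgroup K G" "K \<subseteq> range rot"
  shows "K \<lhd> G"
proof -
  have "g \<otimes> h \<otimes> inv g \<in> K" if g: "g \<in> carrier G" and h: "h \<in> K" for g h
  proof -
    obtain x where x: "h = rot x" using h assms by blast
    have "inv h \<in> K" using h assms by (simp add: subgroup.m_inv_closed)
    then show ?thesis using h by (cases rule: carrierE[OF g]) (simp_all add: x)
  qed
  then show ?thesis using assms by (simp add: normal_inv_iff)
qed

text \<open>The rotation indices of \<open>K\<close> form an ideal generated by some
  \<open>d\<close>, and multiplying by one fixed reflection \<open>ref i\<close> of \<open>K\<close>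
  turns its reflections into its rotations.\<close>

lemma nonrotational_subgroup:
  assumes n: "n > 0" and K: "subgroup K G" "\<not> K \<subseteq> range rot"
  shows "\<exists>d i. d dvd n \<and> K = sub (int d) i"
proof -
  have "rot (x - y) \<in> K" if "rot x \<in> K" "rot y \<in> K" for x y
    using subgroup.m_closed[OF K(1) that(1) subgroup.m_inv_closed[OF K(1) that(2)]] by simp
  \<comment> \<open>This is the identity; its index is the positive element that yields
    \<open>d\<close>, and it also gives that \<open>d\<close> divides \<open>n\<close>.\<close>
  moreover have "rot (int n) \<in> K"
    using subgroup.one_closed[OF K(1)] by (simp add: one_eq rot_eq_iff[of "int n" 0, THEN iffD2])
  ultimately obtain d where d: "rot x \<in> K \<longleftrightarrow> int d dvd x" for x
    using int_subgroup_cyclic[of "{x. rot x \<in> K}" n] n by auto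
  obtain i where i: "ref i \<in> K"
    using K(2) subgroup.subset[OF K(1)] unfolding carrier_eq by blast
  have ref: "ref x \<in> K \<longleftrightarrow> int d dvd x - i" for x
  proof
    assume "ref x \<in> K"
    then have "ref x \<otimes> ref i \<in> K" using i K by (blast intro: subgroup.m_closed)
    then show "int d dvd x - i" by (simp add: d)
  next
    assume "int d dvd x - i"
    then have "rot (x - i) \<otimes> ref i \<in> K" using i K by (intro subgroup.m_closed) (simp_all add: d)
    then show "ref x \<in> K" by simp
  qed
  have "K = sub (int d) i"
    using subgroup.subset[OF K(1)] by (auto simp: carrier_eq sub_def d ref)
  moreover have "d dvd n" using d[of "int n"] \<open>rot (int n) \<in> K\<close> by simp
  ultimately show ?thesis by blast
qed

text \<open>Properness is automatic since the whole group is normal, and a non-normal subgroup must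
  contain a reflection.\<close>

lemma pverts_perm_graph_nonnormal:
  assumes "n > 0"
  shows "pverts (perm_graph_nonnormal G) = {sub (int d) i | d i. d dvd n \<and> \<not> d dvd 2}"
proof -
  have "carrier G \<lhd> G" by (simp add: normal_inv_iff subgroup_self)
  then have "pverts (perm_graph_nonnormal G) = {K. subgroup K G \<and> \<not> K \<lhd> G}"
    by (auto simp: perm_graph_nonnormal_def Let_def)
  moreover have "subgroup K G \<and> \<not> K \<lhd> G \<longleftrightarrow>
    (\<exists>d i. K = sub (int d) i \<and> d dvd n \<and> \<not> d dvd 2)" for K
  proof -
    have normal: "sub (int d) i \<lhd> G \<longleftrightarrow> d dvd 2" if "d dvd n" for d i
      using that sub_normal_iff[of "int d" i] by (metis int_dvd_int_iff of_nat_numeral)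
    show ?thesis
    proof
      assume K: "subgroup K G \<and> \<not> K \<lhd> G"
      then obtain d i where "d dvd n" "K = sub (int d) i"
        using nonrotational_subgroup[OF assms] rotations_normal by metis
      then show "\<exists>d i. K = sub (int d) i \<and> d dvd n \<and> \<not> d dvd 2"
        using K normal by metis
    next
      assume "\<exists>d i. K = sub (int d) i \<and> d dvd n \<and> \<not> d dvd 2"
      then show "subgroup K G \<and> \<not> K \<lhd> G" using normal sub_subgroup by metis
    qed
  qed
  ultimately show ?thesis by simp
qed

lemma parcs_perm_graph_nonnormal:
  "(H, K) \<in> parcs (perm_graph_nonnormal G) \<longleftrightarrow>
     H \<in> pverts (perm_graph_nonnormal G) \<and> K \<in> pverts (perm_graph_nonnormal G) \<and>
     H \<noteq> K \<and> H <#> K = K <#> H"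
  by (simp add: perm_graph_nonnormal_def Let_def)

end

section \<open>Recognizing a component from a spanning path and closure under adjacency\<close>

section \<open>Connected components and Hamiltonian paths\<close>

lemma vwalk_hd_reachable:
  assumes "wf_digraph H" "vwalk p H" "v \<in> set p"
  shows "hd p \<rightarrow>\<^sup>*\<^bsub>H\<^esub> v"
proof -
  interpret wf_digraph H by fact
  show ?thesis using assms(2,3)
  proof (induction arbitrary: v rule: vwalk_induct)
    case (Base u)
    then show ?case by simp
  next
    case (Cons x y es)
    then show ?case by (auto intro: adj_reachable_trans simp: adj_in_verts)
  qed
qed

text \<open>Every vertex is reachable from the head of the path; in the symmetric closure the first
  of two such connections can be reversed.\<close>

lemma hamiltonian_path_connected:
  assumes "wf_digraph H" "hamiltonian_path p H"
  shows "connected H"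
  unfolding connected_def
proof (rule strongly_connectedI)
  interpret wf_digraph H by fact
  interpret S: pair_wf_digraph "mk_symmetric H" by (rule wellformed_mk_symmetric)
  have p: "vwalk p H" "set p = verts H" "p \<noteq> []"
    using assms by (auto simp: hamiltonian_path_def vpath_def vwalk_def)
  then show "verts (with_proj (mk_symmetric H)) \<noteq> {}" by auto
  fix u v
  assume "u \<in> verts (with_proj (mk_symmetric H))" "v \<in> verts (with_proj (mk_symmetric H))"
  then have "hd p \<rightarrow>\<^sup>*\<^bsub>mk_symmetric H\<^esub> u" "hd p \<rightarrow>\<^sup>*\<^bsub>mk_symmetric H\<^esub> v"
    using p vwalk_hd_reachable[OF assms(1) p(1)] by (auto intro: reachable_mk_symmetricI)
  then show "u \<rightarrow>\<^sup>*\<^bsub>mk_symmetric H\<^esub> v"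
    by (metis S.reachable_trans symmetric_reachable symmetric_mk_symmetric)
qed

text \<open>A walk in \<open>C\<close> from a common vertex cannot leave \<open>S\<close>, so
  \<open>C\<close> lies in the connected induced subgraph, and maximality forces equality.\<close>

lemma connected_component_eq_induce:
  assumes "wf_digraph G" and C: "connected_component G C"
    and S: "S \<subseteq> verts G" "connected (G \<restriction> S)" "verts C \<inter> S \<noteq> {}"
    and closed: "\<And>e. e \<in> arcs G \<Longrightarrow> tail G e \<in> S \<longleftrightarrow> head G e \<in> S"
  shows "C = G \<restriction> S"
proof (rule ccontr)
  assume neq: "C \<noteq> G \<restriction> S"
  interpret wf_digraph G by fact
  have sub: "subgraph C G" and conn: "connected C"
    and max: "\<And>H'. H' \<noteq> C \<Longrightarrow> subgraph C H' \<Longrightarrow> subgraph H' G \<Longrightarrow> \<not> connected H'"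
    using C by (auto simp: connected_component_def max_subgraph_def)
  have comp: "tail C = tail G" "head C = head G" and arcs: "arcs C \<subseteq> arcs G" and wfC: "wf_digraph C"
    using sub by (auto simp: subgraph_def compatible_def)
  obtain c where c: "c \<in> verts C" "c \<in> S" using S by blast
  have "v \<in> S" if "v \<in> verts C" for v
  proof -
    have "c \<rightarrow>\<^sup>*\<^bsub>mk_symmetric C\<^esub> v"
      using conn c that by (auto simp: connected_def strongly_connected_def)
    then have "(c, v) \<in> (parcs (mk_symmetric C))\<^sup>*"
      using reachable_rtranclI by fastforce
    then show "v \<in> S"
      using c arcs closed by induction (auto simp: parcs_mk_symmetric comp)
  qed
  then have "subgraph C (G \<restriction> S)"
    using arcs wfC wf_digraph.tail_in_verts[OF wfC] wf_digraph.head_in_verts[OF wfC]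
    by (intro subgraphI) (auto simp: comp compatible_def wellformed_induce_subgraph)
  moreover have "subgraph (G \<restriction> S) G"
    using S by (simp add: subgraph_induce_subgraphI)
  ultimately show False using max neq S by metis
qed

lemma vwalk_arcs_successively:
  assumes "successively P p" "(u, v) \<in> set (vwalk_arcs p)"
  shows "P u v"
  using assms by (induction p rule: vwalk_arcs.induct) auto

lemma set_vwalk_arcs_subset: "set (vwalk_arcs p) \<subseteq> set p \<times> set p"
  by (induction p rule: vwalk_arcs.induct) auto

lemma distinct_vwalk_arcs_neq:
  assumes "distinct p" "(u, v) \<in> set (vwalk_arcs p)"
  shows "u \<noteq> v"
  using assms by (induction p rule: vwalk_arcs.induct) auto

section \<open>The recursive Hamiltonian path through a parity class\<close>

section \<open>Dihedral groups of order a power of two\<close>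

text \<open>A residue class modulo 2^k splits into two classes modulo 2^(k+1), by the parity of the
  quotient. This is the branching of the path recursion.\<close>

lemma two_power_Suc_dvd_iff:
  "(2::int) ^ k dvd j - i \<longleftrightarrow> 2 ^ Suc k dvd j - i \<or> 2 ^ Suc k dvd j - (i + 2 ^ k)"
proof
  assume "(2::int) ^ k dvd j - i"
  then obtain q where q: "j - i = 2 ^ k * q" ..
  show "2 ^ Suc k dvd j - i \<or> 2 ^ Suc k dvd j - (i + 2 ^ k)"
  proof (cases "even q")
    case True
    then show ?thesis by (auto simp: q elim!: evenE)
  next
    case False
    then obtain r where "q = 2 * r + 1" by (elim oddE)
    then have "j - (i + 2 ^ k) = 2 ^ Suc k * r" using q by (simp add: algebra_simps)
    then show ?thesis by simp
  qed
next
  assume "2 ^ Suc k dvd j - i \<or> 2 ^ Suc k dvd j - (i + 2 ^ k)"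
  then have "2 ^ k dvd j - i \<or> 2 ^ k dvd j - (i + 2 ^ k)"
    using dvd_trans[OF le_imp_power_dvd[of k "Suc k" "2::int"]] by auto
  then show "2 ^ k dvd j - i"
    using dvd_add[of "2 ^ k" "j - (i + 2 ^ k)" "2 ^ k"] by auto
qed

locale dihedral_two_power = dihedral +
  fixes \<alpha> :: nat
  assumes n_eq: "n = 2 ^ \<alpha>"
begin

lemma two_power_dvd_n [simp]: "l \<le> \<alpha> \<Longrightarrow> 2 ^ l dvd int n"
  by (simp add: n_eq le_imp_power_dvd)

lemma pverts_eq:
  "pverts (perm_graph_nonnormal G) = {sub (2 ^ l) j | l j. 1 < l \<and> l \<le> \<alpha>}"
proof -
  have "\<not> (2::nat) ^ l dvd 2 \<longleftrightarrow> 1 < l" for l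
    using power_dvd_imp_le[of "2::nat" l 1] le_imp_power_dvd[of l 1 "2::nat"] by (auto simp: not_le[symmetric])
  then have "d dvd n \<and> \<not> d dvd 2 \<longleftrightarrow> (\<exists>l. d = 2 ^ l \<and> 1 < l \<and> l \<le> \<alpha>)" for d
    unfolding n_eq divides_primepow_nat[OF two_is_prime_nat] by metis
  then have "pverts (perm_graph_nonnormal G) =
      {sub (int d) i | d i. \<exists>l. d = 2 ^ l \<and> 1 < l \<and> l \<le> \<alpha>}"
    by (simp add: pverts_perm_graph_nonnormal n_eq)
  also have "\<dots> = {sub (int (2 ^ l)) j | l j. 1 < l \<and> l \<le> \<alpha>}" by blast
  finally show ?thesis by simp
qed

text \<open>The first argument counts the levels still to be visited, k + 1 up to k + m, which makes
  the recursion primitive; the path P(k,i) is \<open>ham (\<alpha> - k) k i\<close>.\<close>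

primrec ham :: "nat \<Rightarrow> nat \<Rightarrow> int \<Rightarrow> 'a set list" where
  "ham 0 k i = []"
| "ham (Suc m) k i = sub (2 ^ Suc k) i # ham m (Suc k) i @
     sub (2 ^ Suc k) (i + 2 ^ k) # ham m (Suc k) (i + 2 ^ k)"

lemma set_ham: "set (ham m k i) = {sub (2 ^ l) j | l j. k < l \<and> l \<le> k + m \<and> 2 ^ k dvd j - i}"
proof -
  have "K \<in> set (ham m k i) \<longleftrightarrow>
    (\<exists>l j. K = sub (2 ^ l) j \<and> k < l \<and> l \<le> k + m \<and> 2 ^ k dvd j - i)" for K
  proof (induction m arbitrary: k i)
    case (Suc m)
    \<comment> \<open>At the lowest level each of the two residue classes contributes a single
      subgroup.\<close>
    have "(\<exists>j. K = sub (2 ^ Suc k) j \<and> 2 ^ Suc k dvd j - i') \<longleftrightarrow> K = sub (2 ^ Suc k) i'" for i'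
      using sub_cong by (metis diff_self dvd_0_right)
    then have "K = sub (2 ^ Suc k) i \<or> K = sub (2 ^ Suc k) (i + 2 ^ k) \<longleftrightarrow>
      (\<exists>j. K = sub (2 ^ Suc k) j \<and> 2 ^ k dvd j - i)"
      unfolding two_power_Suc_dvd_iff[of k _ i] by blast
    then have "K \<in> set (ham (Suc m) k i) \<longleftrightarrow>
      (\<exists>j. K = sub (2 ^ Suc k) j \<and> 2 ^ k dvd j - i) \<or>
      (\<exists>l j. K = sub (2 ^ l) j \<and> Suc k < l \<and> l \<le> Suc k + m \<and> 2 ^ k dvd j - i)"
      unfolding ham.simps set_append list.set Un_iff insert_iff Suc
        two_power_Suc_dvd_iff[of k _ i] by blast
    moreover have "k < l \<and> l \<le> k + Suc m \<longleftrightarrow> l = Suc k \<or> Suc k < l \<and> l \<le> Suc k + m" for l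
      by auto
    ultimately show ?case by metis
  qed simp
  then show ?thesis by blast
qed

text \<open>The index of \<open>K\<close> agrees with \<open>j\<close> modulo 2^k, and the factor 2
  in \<open>sub_permute\<close> supplies the missing power. Keeping \<open>j\<close> apart from
  \<open>i\<close> covers both halves of the recursion.\<close>

lemma ham_permute:
  assumes "K \<in> set (ham m (Suc k) i)" "2 ^ k dvd i - j"
  shows "sub (2 ^ Suc k) j <#> K = K <#> sub (2 ^ Suc k) j"
proof -
  obtain l i' where K: "K = sub (2 ^ l) i'" and l: "Suc k < l" and i': "2 ^ Suc k dvd i' - i"
    using assms unfolding set_ham by blast
  have "2 ^ k dvd (i' - i) + (i - j)"
    using i' assms(2) two_power_Suc_dvd_iff[of k i' i] by (intro dvd_add) auto
  then have "2 ^ k dvd j - i'" by (simp add: dvd_diff_commute)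
  then have "2 ^ Suc k dvd 2 * (j - i')" unfolding power_Suc by (intro mult_dvd_mono) simp_all
  then show ?thesis
    unfolding K using l by (intro sub_permute le_imp_power_dvd) simp_all
qed

text \<open>The bound makes every 2^l that occurs a divisor of \<open>n\<close>, so that a subgroup
  determines its level and its residue class.\<close>

lemma distinct_ham: "k + m \<le> \<alpha> \<Longrightarrow> distinct (ham m k i)"
proof (induction m arbitrary: k i)
  case (Suc m)
  have disj: "\<not> (2::int) ^ Suc k dvd 2 ^ k"
    using zdvd_imp_le[of "2 ^ Suc k" "2 ^ k"] by auto
  have eqD: "l = l' \<and> 2 ^ l dvd j - j'"
    if "sub (2 ^ l) j = sub (2 ^ l') j'" "l \<le> k + Suc m" "l' \<le> k + Suc m" for l l' j j'
    using sub_eqD[of "2 ^ l" "2 ^ l'" j j'] that Suc.prems by auto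
  have "sub (2 ^ Suc k) j \<notin> set (ham m (Suc k) i')" for j i'
    by (auto simp: set_ham simp del: power_Suc dest!: eqD)
  moreover have "sub (2 ^ Suc k) i \<noteq> sub (2 ^ Suc k) (i + 2 ^ k)"
    using disj by (auto simp del: power_Suc dest!: eqD)
  \<comment> \<open>A common entry would identify the classes of i and i + 2^k modulo
    2^(k+1).\<close>
  moreover have "set (ham m (Suc k) i) \<inter> set (ham m (Suc k) (i + 2 ^ k)) = {}"
  proof (rule ccontr)
    assume "set (ham m (Suc k) i) \<inter> set (ham m (Suc k) (i + 2 ^ k)) \<noteq> {}"
    then obtain l l' j j' where l: "Suc k < l" "l \<le> k + Suc m" "l' \<le> k + Suc m"
      and j: "2 ^ Suc k dvd j - i" "2 ^ Suc k dvd j' - (i + 2 ^ k)"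
      and eq: "sub (2 ^ l) j = sub (2 ^ l') j'"
      by (auto simp: set_ham simp del: power_Suc)
    have "2 ^ Suc k dvd j - j'"
      using eqD[OF eq l(2,3)] l(1) by (meson le_imp_power_dvd dvd_trans less_imp_le)
    then have "2 ^ Suc k dvd (j - i) - (j' - (i + 2 ^ k)) - (j - j')"
      by (rule dvd_diff[OF dvd_diff[OF j]])
    then show False using disj by simp
  qed
  ultimately show ?case using Suc by simp
qed simp

lemma successively_ham: "successively (\<lambda>H K. H <#> K = K <#> H) (ham m k i)"
proof (induction m arbitrary: k i)
  case (Suc m)
  define P where "P H K \<longleftrightarrow> H <#> K = K <#> H" for H K
  let ?A = "sub (2 ^ Suc k) i" and ?B = "sub (2 ^ Suc k) (i + 2 ^ k)"
  let ?p = "ham m (Suc k) i" and ?q = "ham m (Suc k) (i + 2 ^ k)"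
  \<comment> \<open>For \<open>m = 0\<close> both tails are empty and these two entries are
    consecutive.\<close>
  have "?A <#> ?B = ?B <#> ?A"
    by (rule sub_permute) simp_all
  then have "P ?A ?B" by (simp only: P_def)
  \<comment> \<open>Since all entries of \<open>?p\<close> permute with both, the ends of
    \<open>?p\<close> need not be known.\<close>
  moreover have "P ?A K" "P K ?B" if "K \<in> set ?p" for K
    unfolding P_def using ham_permute[OF that, of i] ham_permute[OF that, of "i + 2 ^ k"] by simp_all
  moreover have "P ?B K" if "K \<in> set ?q" for K
    unfolding P_def using ham_permute[OF that, of "i + 2 ^ k"] by simp
  moreover have "successively P ?p" "successively P ?q"
    using Suc by (simp_all add: P_def[abs_def])
  ultimately have "successively P (ham (Suc m) k i)"
    unfolding ham.simps by (cases "?p = []"; cases "?q = []")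
      (auto simp: successively_Cons successively_append_iff)
  then show ?case by (simp only: P_def[abs_def])
qed simp

lemma set_ham_1:
  assumes "\<alpha> \<ge> 2"
  shows "set (ham (\<alpha> - 1) 1 i) = {sub (2 ^ l) j | l j. 1 < l \<and> l \<le> \<alpha> \<and> 2 dvd j - i}"
  using assms by (simp add: set_ham)

lemma hamiltonian_path_ham:
  assumes "\<alpha> \<ge> 2"
  shows "hamiltonian_path (ham (\<alpha> - 1) 1 i)
    (with_proj (perm_graph_nonnormal G) \<restriction> set (ham (\<alpha> - 1) 1 i))"
proof -
  let ?p = "ham (\<alpha> - 1) 1 i"
  have verts: "set ?p \<subseteq> pverts (perm_graph_nonnormal G)"
    unfolding set_ham_1[OF assms] pverts_eq by blast
  have dist: "distinct ?p" using assms by (intro distinct_ham) simp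
  have "(H, K) \<in> parcs (perm_graph_nonnormal G)" "H \<in> set ?p" "K \<in> set ?p"
    if "(H, K) \<in> set (vwalk_arcs ?p)" for H K
    using that verts distinct_vwalk_arcs_neq[OF dist that] set_vwalk_arcs_subset[of ?p]
      vwalk_arcs_successively[OF successively_ham that]
    by (auto simp only: parcs_perm_graph_nonnormal)
  moreover have "?p \<noteq> []" using assms by (cases "\<alpha> - 1") auto
  ultimately show ?thesis using dist
    by (auto simp: hamiltonian_path_def vpath_def vwalk_def arcs_ends_conv)
qed

text \<open>All levels are at least 2, so \<open>sub_permuteD\<close> applies with
  \<open>c = 4\<close> and shows that permuting subgroups have indices of equal parity.\<close>

lemma mem_ham_permuteD:
  assumes "\<alpha> \<ge> 2" "H \<in> set (ham (\<alpha> - 1) 1 i)" "K \<in> pverts (perm_graph_nonnormal G)"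
    and HK: "H <#> K = K <#> H"
  shows "K \<in> set (ham (\<alpha> - 1) 1 i)"
proof -
  obtain l j where H: "H = sub (2 ^ l) j" "1 < l" "l \<le> \<alpha>" "2 dvd j - i"
    using assms(2) unfolding set_ham_1[OF assms(1)] by blast
  obtain l' j' where K: "K = sub (2 ^ l') j'" "1 < l'" "l' \<le> \<alpha>"
    using assms(3) unfolding pverts_eq by blast
  have four: "4 dvd (2::int) ^ r" if "1 < r" for r
    using le_imp_power_dvd[of 2 r "2::int"] that by simp
  have "4 dvd int n" using four[of \<alpha>] assms(1) by (simp add: n_eq)
  then have "4 dvd 2 * (j - j')"
    using HK four H(2) K(2) unfolding H(1) K(1) by (intro sub_permuteD[of _ "2 ^ l" "2 ^ l'"]) simp_all
  then have "2 dvd j' - i" using H(4) by presburger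
  then show ?thesis using K unfolding set_ham_1[OF assms(1)] by blast
qed

lemma component_has_hamiltonian_path:
  assumes "\<alpha> \<ge> 2" and C: "connected_component (with_proj (perm_graph_nonnormal G)) C"
  shows "\<exists>p. hamiltonian_path p C"
proof -
  let ?\<Gamma> = "perm_graph_nonnormal G"
  interpret pair_bidirected_digraph ?\<Gamma>
    by (rule pair_bidirected_digraph_perm_graph_nonnormal)
  have sub: "subgraph C ?\<Gamma>" and "connected C"
    using C by (auto simp: connected_component_def pre_digraph.max_subgraph_def)
  then obtain K where K: "K \<in> verts C"
    by (auto simp: connected_def strongly_connected_def)
  then have "K \<in> pverts ?\<Gamma>" using sub by (auto simp: subgraph_def)
  \<comment> \<open>The index of an arbitrary vertex of \<open>C\<close> selects the parity class
    that \<open>C\<close> must be.\<close>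
  then obtain l j where l: "K = sub (2 ^ l) j" "1 < l" "l \<le> \<alpha>"
    unfolding pverts_eq by blast
  let ?p = "ham (\<alpha> - 1) 1 j"
  have ham: "hamiltonian_path ?p (?\<Gamma> \<restriction> set ?p)"
    by (rule hamiltonian_path_ham) fact
  have "C = ?\<Gamma> \<restriction> set ?p"
  proof (rule connected_component_eq_induce[OF _ C])
    show "wf_digraph ?\<Gamma>" by unfold_locales
    show "set ?p \<subseteq> verts ?\<Gamma>"
      unfolding set_ham_1[OF assms(1)] with_proj_simps pverts_eq by blast
    show "connected (?\<Gamma> \<restriction> set ?p)"
      using ham by (rule hamiltonian_path_connected[rotated]) (rule wellformed_induce_subgraph)
    have "K \<in> set ?p" using l unfolding set_ham_1[OF assms(1)] by force
    then show "verts C \<inter> set ?p \<noteq> {}" using K by blast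
    fix e assume "e \<in> arcs ?\<Gamma>"
    then show "tail ?\<Gamma> e \<in> set ?p \<longleftrightarrow> head ?\<Gamma> e \<in> set ?p"
      using mem_ham_permuteD[OF assms(1)]
      by (cases e) (simp add: parcs_perm_graph_nonnormal, metis)
  qed
  then show ?thesis using ham by auto
qed

end

theorem theorem4p7:
  fixes n \<alpha> :: nat
  assumes "\<alpha> \<ge> 2" and "n = 2 ^ \<alpha>"
  shows "\<forall>C. connected_component (with_proj (perm_graph_nonnormal (dihedral_group n))) C
           \<longrightarrow> (\<exists>p. hamiltonian_path p C)"
proof (intro allI impI)
  fix C assume C: "connected_component (with_proj (perm_graph_nonnormal (dihedral_group n))) C"
  interpret dihedral_two_power "dihedral_group n" n
    "\<lambda>i. {w. int n dvd rot_exp w - i \<and> \<not> flips w}"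
    "\<lambda>i. {w. int n dvd rot_exp w - i \<and> flips w}" \<alpha>
    by (intro dihedral_two_power.intro dihedral_dihedral_group dihedral_two_power_axioms.intro assms)
  show "\<exists>p. hamiltonian_path p C"
    using assms(1) C by (rule component_has_hamiltonian_path)
qed

end
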